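(* Suppose the counterfactual distribution $\mathrm{pr}(Y_0=\cdot\mid Z=1)$ is identifiable. If $0\le Y_1-Y_0\le 1$ (monotonic incremental treatment effect), then for every $k=1,\ldots,J-1$, $$\max\left(0,\ \mathrm{pr}(Y_1=k\mid Z=1)+\mathrm{pr}(Y_0=k-1\mid Z=1)-1\right)\le \delta_{k\mid 1}\le \min\left(\mathrm{pr}(Y_1=k\mid Z=1),\ \mathrm{pr}(Y_0=k-1\mid Z=1)\right),$$ where $\delta_{k\mid 1}=\sum_{j=0}^{k-1}\{\mathrm{pr}(Y_0=j\mid Z=1)-\mathrm{pr}(Y_1=j\mid Z=1)\}$.
   Context: $Z\in\{0,1\}$ is a binary treatment with $\mathrm{pr}(Z=1)>0$, and $Y$ is an observed ordinal outcome with levels $0,\ldots,J-1$ ($J\ge 2$). $Y_1,Y_0\in\{0,\ldots,J-1\}$ are the potential outcomes under treatment and control, all on a common probability space, and $Y=Y_z$ on $\{Z=z\}$. Identifiability of $\mathrm{pr}(Y_0=\cdot\mid Z=1)$ means that this distribution is treated as known, as is $\mathrm{pr}(Y_1=\cdot\mid Z=1)=\mathrm{pr}(Y=\cdot\mid Z=1)$. Inequalities between random variables hold for all units. *)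

theory Defs
  imports "HOL-Probability.Probability"
begin

text \<open>Measurability into \<open>count_space A\<close> also says that all values on the sample space lie in \<open>A\<close>.
  The consistency conditions are pointwise, that is, they hold for every unit.\<close>

locale ordinal_potential_outcomes = prob_space M
  for M :: "'a measure" +
  fixes J :: nat and Z Y Y1 Y0 :: "'a \<Rightarrow> nat"
  assumes levels: "J \<ge> 2"
    and treatment_rv: "Z \<in> M \<rightarrow>\<^sub>M count_space {0, 1}"
    and observed_rv: "Y \<in> M \<rightarrow>\<^sub>M count_space {0..J - 1}"
    and treated_outcome_rv: "Y1 \<in> M \<rightarrow>\<^sub>M count_space {0..J - 1}"
    and control_outcome_rv: "Y0 \<in> M \<rightarrow>\<^sub>M count_space {0..J - 1}"
    and treated_pos: "\<P>(\<omega> in M. Z \<omega> = 1) > 0"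
    and consistency1: "\<And>\<omega>. \<omega> \<in> space M \<Longrightarrow> Z \<omega> = 1 \<Longrightarrow> Y \<omega> = Y1 \<omega>"
    and consistency0: "\<And>\<omega>. \<omega> \<in> space M \<Longrightarrow> Z \<omega> = 0 \<Longrightarrow> Y \<omega> = Y0 \<omega>"

text \<open>Identifiability of the counterfactual distribution: it is a known distribution \<open>q\<close>.
  Its analogue for \<open>Y1\<close> needs no assumption: by consistency that distribution is the
  observable \<open>\<P>(\<omega> in M. Y \<omega> = j \<bar> Z \<omega> = 1)\<close>.\<close>

definition counterfactual_known ::
  "'a measure \<Rightarrow> ('a \<Rightarrow> nat) \<Rightarrow> ('a \<Rightarrow> nat) \<Rightarrow> nat pmf \<Rightarrow> bool" where
  "counterfactual_known M Z Y0 q \<longleftrightarrow>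
     (\<forall>j. \<P>(\<omega> in M. Y0 \<omega> = j \<bar> Z \<omega> = 1) = pmf q j)"

definition delta_treated ::
  "'a measure \<Rightarrow> ('a \<Rightarrow> nat) \<Rightarrow> ('a \<Rightarrow> nat) \<Rightarrow> ('a \<Rightarrow> nat) \<Rightarrow> nat \<Rightarrow> real" where
  "delta_treated M Z Y1 Y0 k =
     (\<Sum>j<k. \<P>(\<omega> in M. Y0 \<omega> = j \<bar> Z \<omega> = 1) - \<P>(\<omega> in M. Y1 \<omega> = j \<bar> Z \<omega> = 1))"

end

theory Submission imports Defs begin

text \<open>Given \<open>Z = 1\<close>, the sum \<open>\<delta>\<close> telescopes to \<open>\<P>(Y0 < k) - \<P>(Y1 < k)\<close>, which by monotonicity is
  \<open>\<P>(Y0 < k \<le> Y1)\<close>. Since the effect is at most one, this event is \<open>{Y1 = k, Y0 = k - 1}\<close>, and the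
  bounds are the Frechet bounds for the joint probability of two events.\<close>

lemma (in finite_measure) measure_sum_levels:
  fixes X :: "'a \<Rightarrow> nat"
  assumes [measurable]: "X \<in> M \<rightarrow>\<^sub>M count_space UNIV"
  shows "(\<Sum>j<k. \<P>(\<omega> in M. X \<omega> = j)) = \<P>(\<omega> in M. X \<omega> < k)"
proof -
  have "measure M (\<Union>j<k. {\<omega> \<in> space M. X \<omega> = j}) = (\<Sum>j<k. \<P>(\<omega> in M. X \<omega> = j))"
    by (intro finite_measure_finite_Union) (auto simp: disjoint_family_on_def)
  moreover have "(\<Union>j<k. {\<omega> \<in> space M. X \<omega> = j}) = {\<omega> \<in> space M. X \<omega> < k}"
    by auto
  ultimately show ?thesis by simp
qed

text \<open>Both sums telescope to tail events, and \<open>W\<close> \<le> \<open>X\<close> nests {X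
  < k} inside {W < k}, so the difference of measures is the measure of the set difference. The
  statement is unconditional, so that it can be applied to the conditional law given
  treatment.\<close>

lemma (in finite_measure) sum_level_diff_eq_joint:
  fixes X W :: "'a \<Rightarrow> nat"
  assumes [measurable]: "X \<in> M \<rightarrow>\<^sub>M count_space UNIV" "W \<in> M \<rightarrow>\<^sub>M count_space UNIV"
    and incr: "\<And>\<omega>. \<omega> \<in> space M \<Longrightarrow> W \<omega> \<le> X \<omega> \<and> X \<omega> \<le> Suc (W \<omega>)"
    and "k \<ge> 1"
  shows "(\<Sum>j<k. \<P>(\<omega> in M. W \<omega> = j) - \<P>(\<omega> in M. X \<omega> = j))
    = \<P>(\<omega> in M. X \<omega> = k \<and> W \<omega> = k - 1)"
proof -
  have "(\<Sum>j<k. \<P>(\<omega> in M. W \<omega> = j) - \<P>(\<omega> in M. X \<omega> = j))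
      = \<P>(\<omega> in M. W \<omega> < k) - \<P>(\<omega> in M. X \<omega> < k)"
    by (simp add: sum_subtractf measure_sum_levels)
  also have "\<dots> = measure M ({\<omega> \<in> space M. W \<omega> < k} - {\<omega> \<in> space M. X \<omega> < k})"
    by (intro finite_measure_Diff[symmetric]) (auto intro: le_less_trans[OF conjunct1[OF incr]])
  also have "{\<omega> \<in> space M. W \<omega> < k} - {\<omega> \<in> space M. X \<omega> < k}
      = {\<omega> \<in> space M. X \<omega> = k \<and> W \<omega> = k - 1}"
  proof (rule set_eqI)
    fix \<omega>
    show "\<omega> \<in> {\<omega> \<in> space M. W \<omega> < k} - {\<omega> \<in> space M. X \<omega> < k}
      \<longleftrightarrow> \<omega> \<in> {\<omega> \<in> space M. X \<omega> = k \<and> W \<omega> = k - 1}"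
      \<comment> \<open>Off the smaller event, W < k \<le> X \<le> W + 1 leaves only X = k and W = k
        - 1. The converse uses \<open>k \<ge> 1\<close>: for k = 0 the truncated
        \<open>k - 1\<close> would be 0, and the right-hand event X = W = 0 could be nonempty
        although the difference is empty.\<close>
      using incr[of \<omega>] \<open>k \<ge> 1\<close> by auto
  qed
  finally show ?thesis .
qed

text \<open>Inclusion-exclusion, with the probability of the union bounded by one; this is the lower
  Frechet bound.\<close>

lemma (in prob_space) prob_Int_ge:
  assumes "A \<in> events" "B \<in> events"
  shows "prob A + prob B - 1 \<le> prob (A \<inter> B)"
  using measure_Un3[of A M B] assms prob_le_1[of "A \<union> B"] by (simp add: fmeasurable_eq_sets)

text \<open>Turns conditional probabilities into ordinary ones under the normalized restriction of
  \<open>M\<close> to the conditioning event, so that the unconditional lemmas above apply.\<close>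

lemma (in finite_measure) cond_prob_eq_measure_uniform:
  assumes "{\<omega> \<in> space M. P \<omega>} \<in> sets M" "{\<omega> \<in> space M. Q \<omega>} \<in> sets M"
    and "\<P>(\<omega> in M. Q \<omega>) > 0"
  shows "\<P>(\<omega> in M. P \<omega> \<bar> Q \<omega>)
    = \<P>(\<omega> in uniform_measure M {\<omega> \<in> space M. Q \<omega>}. P \<omega>)"
proof -
  have "{\<omega> \<in> space M. Q \<omega>} \<inter> {\<omega> \<in> space M. P \<omega>} = {\<omega> \<in> space M. P \<omega> \<and> Q \<omega>}"
    by auto
  then show ?thesis
    using assms by (simp add: cond_prob_def emeasure_eq_measure)
qed

theorem proposition1:
  fixes M :: "'a measure" and J :: nat and Z Y Y1 Y0 :: "'a \<Rightarrow> nat" and q :: "nat pmf"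
  assumes "ordinal_potential_outcomes M J Z Y Y1 Y0"
    and "counterfactual_known M Z Y0 q"
    and "\<forall>\<omega>\<in>space M. 0 \<le> int (Y1 \<omega>) - int (Y0 \<omega>) \<and> int (Y1 \<omega>) - int (Y0 \<omega>) \<le> 1"
  shows "\<forall>k\<in>{1..J - 1}.
      max 0 (\<P>(\<omega> in M. Y1 \<omega> = k \<bar> Z \<omega> = 1) + \<P>(\<omega> in M. Y0 \<omega> = k - 1 \<bar> Z \<omega> = 1) - 1)
        \<le> delta_treated M Z Y1 Y0 k \<and>
      delta_treated M Z Y1 Y0 k
        \<le> min (\<P>(\<omega> in M. Y1 \<omega> = k \<bar> Z \<omega> = 1)) (\<P>(\<omega> in M. Y0 \<omega> = k - 1 \<bar> Z \<omega> = 1))"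
proof
  fix k assume "k \<in> {1..J - 1}"
  then have "k \<ge> 1" by simp
  interpret ordinal_potential_outcomes M J Z Y Y1 Y0 by fact
  \<comment> \<open>The locale gives measurability into the finite sets of levels; enlarging the
    target to \<open>UNIV\<close> matches the lemmas above and lets events such as Y1 = k be handled
    automatically.\<close>
  have Z[measurable]: "Z \<in> M \<rightarrow>\<^sub>M count_space UNIV"
    by (rule measurable_compose[OF treatment_rv, of "\<lambda>x. x"]) simp
  have Y1[measurable]: "Y1 \<in> M \<rightarrow>\<^sub>M count_space UNIV"
    by (rule measurable_compose[OF treated_outcome_rv, of "\<lambda>x. x"]) simp
  have Y0[measurable]: "Y0 \<in> M \<rightarrow>\<^sub>M count_space UNIV"
    by (rule measurable_compose[OF control_outcome_rv, of "\<lambda>x. x"]) simp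
  \<comment> \<open>\<open>N\<close> is the conditional law given Z = 1. It keeps the sample space
    and sigma-algebra of \<open>M\<close>, and \<open>treated_pos\<close> makes it a probability
    measure.\<close>
  define N where "N = uniform_measure M {\<omega> \<in> space M. Z \<omega> = 1}"
  have [measurable_cong]: "sets N = sets M" and sp: "space N = space M"
    by (simp_all add: N_def)
  interpret N: prob_space N
    unfolding N_def using treated_pos
    by (intro prob_space_uniform_measure) (auto simp: emeasure_eq_measure)
  have c1: "\<P>(\<omega> in M. Y1 \<omega> = j \<bar> Z \<omega> = 1) = \<P>(\<omega> in N. Y1 \<omega> = j)"
    and c0: "\<P>(\<omega> in M. Y0 \<omega> = j \<bar> Z \<omega> = 1) = \<P>(\<omega> in N. Y0 \<omega> = j)" for j
    using treated_pos unfolding N_def by (simp_all add: cond_prob_eq_measure_uniform)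
  let ?A = "{\<omega> \<in> space N. Y1 \<omega> = k}" and ?B = "{\<omega> \<in> space N. Y0 \<omega> = k - 1}"
  \<comment> \<open>Since \<open>N\<close> lives on the whole sample space, the bounds must hold at
    every unit, as the hypothesis grants. Writing them with \<open>Suc\<close> avoids truncated
    subtraction on the naturals.\<close>
  have "Y0 \<omega> \<le> Y1 \<omega> \<and> Y1 \<omega> \<le> Suc (Y0 \<omega>)" if "\<omega> \<in> space N" for \<omega>
    using assms(3) that sp by force
  then have "delta_treated M Z Y1 Y0 k = \<P>(\<omega> in N. Y1 \<omega> = k \<and> Y0 \<omega> = k - 1)"
    unfolding delta_treated_def c1 c0
    using \<open>k \<ge> 1\<close> by (intro N.sum_level_diff_eq_joint) auto
  also have "{\<omega> \<in> space N. Y1 \<omega> = k \<and> Y0 \<omega> = k - 1} = ?A \<inter> ?B"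
    by auto
  finally have delta: "delta_treated M Z Y1 Y0 k = measure N (?A \<inter> ?B)" .
  have "measure N ?A + measure N ?B - 1 \<le> measure N (?A \<inter> ?B)"
    by (rule N.prob_Int_ge) measurable
  moreover have "measure N (?A \<inter> ?B) \<le> measure N ?A" "measure N (?A \<inter> ?B) \<le> measure N ?B"
    by (rule N.finite_measure_mono; measurable; blast)+
  \<comment> \<open>The remaining bound, by 0 from below, is nonnegativity of the joint
    probability.\<close>
  ultimately show "max 0 (\<P>(\<omega> in M. Y1 \<omega> = k \<bar> Z \<omega> = 1) + \<P>(\<omega> in M. Y0 \<omega> = k - 1 \<bar> Z \<omega> = 1) - 1)
        \<le> delta_treated M Z Y1 Y0 k \<and>
      delta_treated M Z Y1 Y0 k
        \<le> min (\<P>(\<omega> in M. Y1 \<omega> = k \<bar> Z \<omega> = 1)) (\<P>(\<omega> in M. Y0 \<omega> = k - 1 \<bar> Z \<omega> = 1))"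
    unfolding delta c1 c0 by simp
qed

end
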